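(* Let $\mathfrak g$ be of type $B_2$ with $c_1=2$, $c_2=1$. Then the highest weight vector $H$ and the lowest weight vector $L$ of $B_0(\lambda)$ are as follows. If $\frac{\lambda_1}{-\lambda_2}>2$: $H=H_{-1}$, $L=L_3$. If $\frac{\lambda_1}{-\lambda_2}=2$: $H=H_{-1}$, $L=L_2$. If $2>\frac{\lambda_1}{-\lambda_2}>1$: $H=H_{-2}$, $L=L_2$. If $\frac{\lambda_1}{-\lambda_2}=1$: $H=H_{-2}$, $L=L_1$. If $1>\frac{\lambda_1}{-\lambda_2}>0$: $H=H_{-3}$, $L=L_1$.
   Context: Setting. $\mathfrak g$ has rank 2, $I=\{1,2\}$, with simple roots $\alpha_i$, simple coroots $h_i$ and Cartan matrix $\langle h_1,\alpha_1\rangle=\langle h_2,\alpha_2\rangle=2$, $\langle h_1,\alpha_2\rangle=-c_1$, $\langle h_2,\alpha_1\rangle=-c_2$; here $c_1=2,c_2=1$. Let $\lambda=\lambda_1\Lambda_1+\lambda_2\Lambda_2$ with $\Lambda_i$ the fundamental weights (so $\langle h_i,\lambda\rangle=\lambda_i$), $\lambda_1\in\mathbb Z_{>0}$, $\lambda_2\in\mathbb Z_{<0}$. The crystal $\mathbb Z^\infty_\iota[\lambda]$. Fix $\iota=(\dots,i_2,i_1,t_\lambda,i_{-1},i_{-2},\dots)=(\dots,1,2,1,t_\lambda,2,1,2,\dots)$, i.e. $i_k=1$ for $k>0$ odd, $i_k=2$ for $k>0$ even, $i_{-k}=2$ for $k>0$ odd, $i_{-k}=1$ for $k>0$ even. As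 a set, $\mathbb Z^\infty_\iota[\lambda]$ consists of the sequences $\vec x=(\dots,x_2,x_1,t_\lambda,x_{-1},x_{-2},\dots)$ with $x_k\in\mathbb Z$ ($k\in\mathbb Z\setminus\{0\}$), all but finitely many zero ($t_\lambda$ is a formal symbol). There is no coordinate $x_0$; sums run over nonzero indices. Put $\sigma_k(\vec x)=x_k+\sum_{j>k}\langle h_{i_k},\alpha_{i_j}\rangle x_j$ for $k\ge1$ and $\sigma_k(\vec x)=-\langle h_{i_k},\lambda\rangle+x_k+\sum_{j>k}\langle h_{i_k},\alpha_{i_j}\rangle x_j$ for $k\le -1$. Let $\sigma^{(i)}(\vec x)=\max_{k:\,i_k=i}\sigma_k(\vec x)$ and $M^{(i)}=\{k: i_k=i,\ \sigma_k(\vec x)=\sigma^{(i)}(\vec x)\}$. The crystal operators are: $\tilde e_i\vec x$ is obtained from $\vec x$ by decreasing $x_{\max M^{(i)}}$ by 1 if $\max M^{(i)}$ exists, and $\tilde e_i\vec x=0$ otherwise; $\tilde f_i\vec x$ is obtained from $\vec x$ by increasing $x_{\min M^{(i)}}$ by 1 if $\min M^{(i)}$ exists, and $\tilde f_i\vec x=0$ otherwise. Also $wt(\vec x)=\lambda-\sum_j x_j\alpha_{i_j}$, $\varepsilon_i(\vec x)=\sigma^{(i)}(\vec x)$, $\varphi_i(\vec x)=\langle h_i,wt(\vec x)\rangle+\varepsilon_i(\vec x)$. $B_0(\lambda)$. The crystal $B(U_q(\mathfrak g)a_\lambda)\cong B(\infty)\otimes T_\lambda\otimes B(-\infty)$ of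 the modified quantum algebra is identified with its image under the unique strict embedding into $\mathbb Z^\infty_\iota[\lambda]$ sending $u_\infty\otimes t_\lambda\otimes u_{-\infty}$ to $(\dots,0,0,t_\lambda,0,0,\dots)$. $B_0(\lambda)$ is its connected component containing $u_\infty\otimes t_\lambda\otimes u_{-\infty}$; equivalently, the connected component of $(\dots,0,0,t_\lambda,0,0,\dots)$ in $\mathbb Z^\infty_\iota[\lambda]$. A highest (resp. lowest) weight vector of a crystal is an element $b$ with $\tilde e_ib=0$ (resp. $\tilde f_ib=0$) for all $i\in I$. The vectors. Let $a_0=a'_0=0$, $a_1=1,a_2=2,a_3=1,a_4=0$ and $a'_1=1,a'_2=1,a'_3=1,a'_4=0$. Put $h_{-2k+1}=a'_{2k-2}\lambda_1+a'_{2k-1}\lambda_2$, $h_{-2k}=a_{2k-1}\lambda_1+a_{2k}\lambda_2$, $l_{2k-1}=a_{2k-1}\lambda_1+a_{2k-2}\lambda_2$, $l_{2k}=a'_{2k}\lambda_1+a'_{2k-1}\lambda_2$ for $k\ge1$ (as far as indices occur), $H_{-j}=(\dots,0,0,t_\lambda,h_{-1},\dots,h_{-j},0,0,\dots)$ and $L_j=(\dots,0,0,l_j,\dots,l_1,t_\lambda,0,0,\dots)$. *)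

theory Defs
  imports Complex_Main
begin

datatype node = N1 | N2

text \<open>\<open>cartan c1 c2 i j\<close> is the pairing of the simple coroot \<open>h\<^sub>i\<close> with the simple root \<open>\<alpha>\<^sub>j\<close>.\<close>

fun cartan :: "int \<Rightarrow> int \<Rightarrow> node \<Rightarrow> node \<Rightarrow> int" where
  "cartan c1 c2 N1 N1 = 2"
| "cartan c1 c2 N2 N2 = 2"
| "cartan c1 c2 N1 N2 = - c1"
| "cartan c1 c2 N2 N1 = - c2"

text \<open>The sequence \<open>\<iota> = (\<dots>,1,2,1,t\<^sub>\<lambda>,2,1,2,\<dots>)\<close>, read with increasing index from right to left.
  The value at the index 0, the place of \<open>t\<^sub>\<lambda>\<close>, is irrelevant.\<close>

definition iota :: "int \<Rightarrow> node" where
  "iota k = (if k > 0 then (if odd k then N1 else N2) else (if odd k then N2 else N1))"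

text \<open>Sequences are functions on the integers; as there is no coordinate \<open>x\<^sub>0\<close>, it is set to 0.
  A weight \<open>\<lambda>\<close> is given by its coordinates \<open>lam i = \<langle>h\<^sub>i, \<lambda>\<rangle>\<close> in the fundamental weights, and the
  argument \<open>A\<close> is the Cartan matrix.\<close>

definition Zinf :: "(int \<Rightarrow> int) set" where
  "Zinf = {x. x 0 = 0 \<and> finite {k. x k \<noteq> 0}}"

definition sigma :: "(node \<Rightarrow> node \<Rightarrow> int) \<Rightarrow> (node \<Rightarrow> int) \<Rightarrow> (int \<Rightarrow> int) \<Rightarrow> int \<Rightarrow> int" where
  "sigma A lam x k =
     (if k < 0 then - lam (iota k) else 0) + x k
     + (\<Sum>j \<in> {j. k < j \<and> j \<noteq> 0 \<and> x j \<noteq> 0}. A (iota k) (iota j) * x j)"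

text \<open>For \<open>x \<in> Zinf\<close> the maximum below is over a finite set of values: \<open>sigma A lam x\<close> is constant
  on the indices of each colour far to the left and far to the right.\<close>

definition sigma_max :: "(node \<Rightarrow> node \<Rightarrow> int) \<Rightarrow> (node \<Rightarrow> int) \<Rightarrow> node \<Rightarrow> (int \<Rightarrow> int) \<Rightarrow> int" where
  "sigma_max A lam i x = Max (sigma A lam x ` {k. k \<noteq> 0 \<and> iota k = i})"

definition Mset :: "(node \<Rightarrow> node \<Rightarrow> int) \<Rightarrow> (node \<Rightarrow> int) \<Rightarrow> node \<Rightarrow> (int \<Rightarrow> int) \<Rightarrow> int set" where
  "Mset A lam i x = {k. k \<noteq> 0 \<and> iota k = i \<and> sigma A lam x k = sigma_max A lam i x}"

text \<open>\<open>None\<close> is the crystal-theoretic 0. \<open>Mset\<close> may be infinite, so its greatest and least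
  elements need not exist.\<close>

definition etilde ::
  "(node \<Rightarrow> node \<Rightarrow> int) \<Rightarrow> (node \<Rightarrow> int) \<Rightarrow> node \<Rightarrow> (int \<Rightarrow> int) \<Rightarrow> (int \<Rightarrow> int) option" where
  "etilde A lam i x =
     (let M = Mset A lam i x in
      if \<exists>m\<in>M. \<forall>k\<in>M. k \<le> m
      then let m = (THE m. m \<in> M \<and> (\<forall>k\<in>M. k \<le> m)) in Some (x(m := x m - 1))
      else None)"

definition ftilde ::
  "(node \<Rightarrow> node \<Rightarrow> int) \<Rightarrow> (node \<Rightarrow> int) \<Rightarrow> node \<Rightarrow> (int \<Rightarrow> int) \<Rightarrow> (int \<Rightarrow> int) option" where
  "ftilde A lam i x =
     (let M = Mset A lam i x in
      if \<exists>m\<in>M. \<forall>k\<in>M. m \<le> k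
      then let m = (THE m. m \<in> M \<and> (\<forall>k\<in>M. m \<le> k)) in Some (x(m := x m + 1))
      else None)"

definition crystal_edge ::
  "(node \<Rightarrow> node \<Rightarrow> int) \<Rightarrow> (node \<Rightarrow> int) \<Rightarrow> (int \<Rightarrow> int) \<Rightarrow> (int \<Rightarrow> int) \<Rightarrow> bool" where
  "crystal_edge A lam x y \<longleftrightarrow> x \<in> Zinf \<and> y \<in> Zinf \<and>
     (\<exists>i. etilde A lam i x = Some y \<or> ftilde A lam i x = Some y)"

text \<open>The connected component of \<open>(\<dots>,0,0,t\<^sub>\<lambda>,0,0,\<dots>)\<close>.\<close>

definition B0 :: "(node \<Rightarrow> node \<Rightarrow> int) \<Rightarrow> (node \<Rightarrow> int) \<Rightarrow> (int \<Rightarrow> int) set" where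
  "B0 A lam = {x. equivclp (crystal_edge A lam) (\<lambda>k. 0) x}"

definition highest_weight_vectors ::
  "(node \<Rightarrow> node \<Rightarrow> int) \<Rightarrow> (node \<Rightarrow> int) \<Rightarrow> (int \<Rightarrow> int) set \<Rightarrow> (int \<Rightarrow> int) set" where
  "highest_weight_vectors A lam B = {b \<in> B. \<forall>i. etilde A lam i b = None}"

definition lowest_weight_vectors ::
  "(node \<Rightarrow> node \<Rightarrow> int) \<Rightarrow> (node \<Rightarrow> int) \<Rightarrow> (int \<Rightarrow> int) set \<Rightarrow> (int \<Rightarrow> int) set" where
  "lowest_weight_vectors A lam B = {b \<in> B. \<forall>i. ftilde A lam i b = None}"

text \<open>The integers \<open>a\<^sub>n\<close> and \<open>a'\<^sub>n\<close>, \<open>n \<le> 4\<close>, for the Cartan matrix \<open>cartan 2 1\<close>.\<close>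

definition a_coef :: "nat \<Rightarrow> int" where
  "a_coef n = [0, 1, 2, 1, 0] ! n"

definition a'_coef :: "nat \<Rightarrow> int" where
  "a'_coef n = [0, 1, 1, 1, 0] ! n"

text \<open>\<open>h_coord lam n\<close> is \<open>h\<^sub>-\<^sub>n\<close> and \<open>l_coord lam n\<close> is \<open>l\<^sub>n\<close>, for \<open>1 \<le> n \<le> 4\<close>.\<close>

definition h_coord :: "(node \<Rightarrow> int) \<Rightarrow> nat \<Rightarrow> int" where
  "h_coord lam n =
     (if odd n then a'_coef (n - 1) * lam N1 + a'_coef n * lam N2
      else a_coef (n - 1) * lam N1 + a_coef n * lam N2)"

definition l_coord :: "(node \<Rightarrow> int) \<Rightarrow> nat \<Rightarrow> int" where
  "l_coord lam n =
     (if odd n then a_coef n * lam N1 + a_coef (n - 1) * lam N2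
      else a'_coef n * lam N1 + a'_coef (n - 1) * lam N2)"

text \<open>\<open>Hvec lam j\<close> is \<open>H\<^sub>-\<^sub>j\<close> and \<open>Lvec lam j\<close> is \<open>L\<^sub>j\<close>.\<close>

definition Hvec :: "(node \<Rightarrow> int) \<Rightarrow> nat \<Rightarrow> int \<Rightarrow> int" where
  "Hvec lam j = (\<lambda>k. if - int j \<le> k \<and> k \<le> - 1 then h_coord lam (nat (- k)) else 0)"

definition Lvec :: "(node \<Rightarrow> int) \<Rightarrow> nat \<Rightarrow> int \<Rightarrow> int" where
  "Lvec lam j = (\<lambda>k. if 1 \<le> k \<and> k \<le> int j then l_coord lam (nat k) else 0)"

end

theory Submission
  imports Defs
begin

text \<open>The vector \<open>H\<close> has the dominant weight \<open>\<mu>\<close> in the Weyl orbit of \<open>\<lambda>\<close>, and its form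
  depends on whether \<open>\<lambda>\<close> is \<open>s\<^sub>2 \<mu>\<close>, \<open>s\<^sub>2 s\<^sub>1 \<mu>\<close> or \<open>s\<^sub>2 s\<^sub>1 s\<^sub>2 \<mu>\<close>, that is by the position of
  \<open>\<lambda>\<^sub>1 / (- \<lambda>\<^sub>2)\<close> relative to 2 and 1. The component \<open>B\<^sub>0(\<lambda>)\<close> should then be the finite crystal of highest
  weight \<open>\<mu>\<close>, whose elements are given by four integers, one for each positive root of \<open>B\<^sub>2\<close>.

  The proof makes this concrete without identifying the crystal. In each of the three cases there is
  a polytope in four of the coordinates \<open>x\<^sub>-\<^sub>3, \<dots>, x\<^sub>3\<close> which contains the zero sequence and whose
  integral points are stable under all four operators (\<open>stable_polytope_s2\<close> and its two companions).
  Since \<open>ftilde\<close> and \<open>etilde\<close> undo each other (\<open>ftilde_etilde\<close>, \<open>etilde_ftilde\<close>), the edge relation is symmetric,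
  and hence \<open>B\<^sub>0(\<lambda>)\<close> lies in the polytope. The conditions \<open>etilde = None\<close> amount to
  linear inequalities \<open>\<sigma>\<^sub>k(x) \<le> 0\<close>, which meet the polytope in the single point \<open>H\<close>; dually for
  \<open>L\<close>. That these points do belong to \<open>B\<^sub>0(\<lambda>)\<close> needs no explicit path: the sum of the coordinates is
  bounded on the polytope and every operator changes it by one, so an element of \<open>B\<^sub>0(\<lambda>)\<close> at which it is least is
  killed by both \<open>etilde\<close> operators and is therefore \<open>H\<close> (\<open>extremal_vectors_unique\<close>).\<close>

section \<open>The crystal operators on finitely supported sequences\<close>

lemma sigma_finite_support:
  assumes "finite F" "{j. x j \<noteq> 0} \<subseteq> F"
  shows "sigma A lam x k = (if k < 0 then - lam (iota k) else 0) + x k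
     + (\<Sum>j\<in>F. if k < j \<and> j \<noteq> 0 then A (iota k) (iota j) * x j else 0)"
proof -
  have "(\<Sum>j\<in>{j. k < j \<and> j \<noteq> 0 \<and> x j \<noteq> 0}. A (iota k) (iota j) * x j)
      = (\<Sum>j\<in>F. if k < j \<and> j \<noteq> 0 then A (iota k) (iota j) * x j else 0)"
    using assms by (intro sum.mono_neutral_cong_left) auto
  then show ?thesis
    unfolding sigma_def by simp
qed

lemma sigma_update:
  assumes "x \<in> Zinf" "m \<noteq> 0"
  shows "sigma A lam (x(m := x m + d)) k
    = sigma A lam x k + (if k = m then d else if k < m then A (iota k) (iota m) * d else 0)"
proof -
  define F where "F = insert m {j. x j \<noteq> 0}"
  have F: "finite F" "m \<in> F" "{j. x j \<noteq> 0} \<subseteq> F" "{j. (x(m := x m + d)) j \<noteq> 0} \<subseteq> F"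
    using assms by (auto simp: F_def Zinf_def)
  have "(\<Sum>j\<in>F. if k < j \<and> j \<noteq> 0 then A (iota k) (iota j) * (x(m := x m + d)) j else 0)
      = (\<Sum>j\<in>F. (if k < j \<and> j \<noteq> 0 then A (iota k) (iota j) * x j else 0)
                + (if j = m then (if k < m then A (iota k) (iota m) * d else 0) else 0))"
    using assms(2) by (intro sum.cong) (auto simp: algebra_simps)
  also have "\<dots> = (\<Sum>j\<in>F. if k < j \<and> j \<noteq> 0 then A (iota k) (iota j) * x j else 0)
                + (if k < m then A (iota k) (iota m) * d else 0)"
    using F by (simp add: sum.distrib)
  finally show ?thesis
    by (simp only: sigma_finite_support[OF F(1,3)] sigma_finite_support[OF F(1,4)]) simp
qed

text \<open>Up to sign, the left value is the pairing of the simple coroot with the weight of \<open>x\<close>.\<close>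

definition left_value :: "(node \<Rightarrow> node \<Rightarrow> int) \<Rightarrow> (node \<Rightarrow> int) \<Rightarrow> node \<Rightarrow> (int \<Rightarrow> int) \<Rightarrow> int" where
  "left_value A lam i x = - lam i + (\<Sum>j \<in> {j. x j \<noteq> 0}. A i (iota j) * x j)"

lemma Zinf_bounded:
  assumes "x \<in> Zinf"
  obtains N where "N > 0" "\<And>k. k \<le> - N \<or> N \<le> k \<Longrightarrow> x k = 0"
proof -
  define N where "N = Max (insert 0 (abs ` {k. x k \<noteq> 0})) + 1"
  have "finite {k. x k \<noteq> 0}"
    using assms by (simp add: Zinf_def)
  then have "\<bar>k\<bar> < N" if "x k \<noteq> 0" for k
    using that unfolding N_def by (intro zle_add1_eq_le[THEN iffD2] Max_ge) auto
  moreover have "N > 0"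
    unfolding N_def using \<open>finite _\<close> by (intro zle_add1_eq_le[THEN iffD2] Max_ge) auto
  ultimately show ?thesis
    using that[of N] by force
qed

lemma sigma_far:
  assumes "x \<in> Zinf"
  obtains N where "N > 0" "\<And>k. N \<le> k \<Longrightarrow> sigma A lam x k = 0"
    "\<And>k. k \<le> - N \<Longrightarrow> sigma A lam x k = left_value A lam (iota k) x"
proof -
  obtain N where N: "N > 0" "\<And>k. k \<le> - N \<or> N \<le> k \<Longrightarrow> x k = 0"
    using Zinf_bounded[OF assms] by blast
  have *: "x j \<noteq> 0 \<Longrightarrow> - N < j \<and> j < N" for j
    using N(2)[of j] by linarith
  show ?thesis
  proof
    show "sigma A lam x k = 0" if "N \<le> k" for k
    proof -
      have "{j. k < j \<and> j \<noteq> 0 \<and> x j \<noteq> 0} = {}"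
        using * that by force
      then show ?thesis
        using that N unfolding sigma_def by simp
    qed
    show "sigma A lam x k = left_value A lam (iota k) x" if "k \<le> - N" for k
    proof -
      have "{j. k < j \<and> j \<noteq> 0 \<and> x j \<noteq> 0} = {j. x j \<noteq> 0}"
        using * that assms by (force simp: Zinf_def)
      then show ?thesis
        using that N unfolding sigma_def left_value_def by simp
    qed
  qed (use N in auto)
qed

lemma colour_unbounded: "\<exists>k>N. k > 0 \<and> iota k = i"
proof -
  have "2 * \<bar>N\<bar> + 1 > N \<and> 2 * \<bar>N\<bar> + 1 > 0 \<and> iota (2 * \<bar>N\<bar> + 1) = N1"
    "2 * \<bar>N\<bar> + 2 > N \<and> 2 * \<bar>N\<bar> + 2 > 0 \<and> iota (2 * \<bar>N\<bar> + 2) = N2"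
    by (auto simp: iota_def)
  then show ?thesis
    by (cases i) blast+
qed

text \<open>This finiteness is what makes the \<open>Max\<close> in \<open>sigma_max\<close> meaningful.\<close>

lemma finite_sigma_range:
  assumes "x \<in> Zinf"
  shows "finite (sigma A lam x ` {k. k \<noteq> 0 \<and> iota k = i})"
proof -
  obtain N where N: "N > 0" "\<And>k. N \<le> k \<Longrightarrow> sigma A lam x k = 0"
    "\<And>k. k \<le> - N \<Longrightarrow> sigma A lam x k = left_value A lam (iota k) x"
    using sigma_far[OF assms] by blast
  have "sigma A lam x k \<in> insert 0 (insert (left_value A lam i x) (sigma A lam x ` {-N..N}))"
    if "iota k = i" for k
    using N(2)[of k] N(3)[of k] that by (cases "N \<le> k"; cases "k \<le> - N") auto
  then have "sigma A lam x ` {k. k \<noteq> 0 \<and> iota k = i}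
      \<subseteq> insert 0 (insert (left_value A lam i x) (sigma A lam x ` {-N..N}))"
    by blast
  then show ?thesis
    by (rule finite_subset) simp
qed

lemma Mset_iff:
  assumes "x \<in> Zinf"
  shows "m \<in> Mset A lam i x \<longleftrightarrow>
    m \<noteq> 0 \<and> iota m = i \<and> (\<forall>k. k \<noteq> 0 \<and> iota k = i \<longrightarrow> sigma A lam x k \<le> sigma A lam x m)"
proof (cases "m \<noteq> 0 \<and> iota m = i")
  case True
  let ?K = "{k. k \<noteq> 0 \<and> iota k = i}"
  have "m \<in> ?K"
    using True by blast
  then have "Max (sigma A lam x ` ?K) = sigma A lam x m
      \<longleftrightarrow> (\<forall>w \<in> sigma A lam x ` ?K. w \<le> sigma A lam x m)"
    by (subst Max_eq_iff[OF finite_sigma_range[OF assms]]) blast+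
  then show ?thesis
    using True unfolding Mset_def sigma_max_def mem_Collect_eq ball_simps
    by (metis (no_types, lifting))
next
  case False
  then show ?thesis
    unfolding Mset_def by blast
qed

lemma Mset_nonempty:
  assumes "x \<in> Zinf"
  shows "Mset A lam i x \<noteq> {}"
proof -
  let ?K = "{k. k \<noteq> 0 \<and> iota k = i}"
  obtain k :: int where "k > 0" "iota k = i"
    using colour_unbounded[of 0 i] by (elim exE conjE)
  then have "sigma A lam x k \<in> sigma A lam x ` ?K"
    by (intro imageI CollectI) simp
  then have "Max (sigma A lam x ` ?K) \<in> sigma A lam x ` ?K"
    using Max_in[OF finite_sigma_range[OF assms, of A lam i]] by (metis empty_iff)
  then obtain m where "m \<in> ?K" "Max (sigma A lam x ` ?K) = sigma A lam x m"
    by (rule imageE)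
  then have "m \<in> Mset A lam i x"
    unfolding Mset_def sigma_max_def mem_Collect_eq by (simp only: simp_thms)
  then show ?thesis
    by (rule ex_in_conv[THEN iffD1, OF exI])
qed

text \<open>The coordinate on which \<open>etilde\<close> (below: \<open>ftilde\<close>) acts, described by comparisons of \<open>sigma\<close> alone, so
  that no maximum has to be computed later.\<close>

definition raising_index ::
  "(node \<Rightarrow> node \<Rightarrow> int) \<Rightarrow> (node \<Rightarrow> int) \<Rightarrow> node \<Rightarrow> (int \<Rightarrow> int) \<Rightarrow> int \<Rightarrow> bool" where
  "raising_index A lam i x m \<longleftrightarrow> m \<noteq> 0 \<and> iota m = i \<and>
     (\<forall>k. k \<noteq> 0 \<and> iota k = i \<longrightarrow> sigma A lam x k \<le> sigma A lam x m \<and>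
        (m < k \<longrightarrow> sigma A lam x k < sigma A lam x m))"

definition lowering_index ::
  "(node \<Rightarrow> node \<Rightarrow> int) \<Rightarrow> (node \<Rightarrow> int) \<Rightarrow> node \<Rightarrow> (int \<Rightarrow> int) \<Rightarrow> int \<Rightarrow> bool" where
  "lowering_index A lam i x m \<longleftrightarrow> m \<noteq> 0 \<and> iota m = i \<and>
     (\<forall>k. k \<noteq> 0 \<and> iota k = i \<longrightarrow> sigma A lam x k \<le> sigma A lam x m \<and>
        (k < m \<longrightarrow> sigma A lam x k < sigma A lam x m))"

lemma raising_index_iff:
  assumes "x \<in> Zinf"
  shows "raising_index A lam i x m \<longleftrightarrow> m \<in> Mset A lam i x \<and> (\<forall>k\<in>Mset A lam i x. k \<le> m)"
  unfolding raising_index_def Ball_def Mset_iff[OF assms]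
  by (smt (verit, best))

lemma lowering_index_iff:
  assumes "x \<in> Zinf"
  shows "lowering_index A lam i x m \<longleftrightarrow> m \<in> Mset A lam i x \<and> (\<forall>k\<in>Mset A lam i x. m \<le> k)"
  unfolding lowering_index_def Ball_def Mset_iff[OF assms]
  by (smt (verit, best))

lemma etilde_Some_iff:
  assumes "x \<in> Zinf"
  shows "etilde A lam i x = Some y \<longleftrightarrow> (\<exists>m. raising_index A lam i x m \<and> y = x(m := x m - 1))"
proof -
  let ?P = "\<lambda>m. m \<in> Mset A lam i x \<and> (\<forall>k\<in>Mset A lam i x. k \<le> m)"
  have "(THE m. ?P m) = m" if "?P m" for m
    using that by (intro the_equality) (auto intro: antisym)
  then show ?thesis
    unfolding etilde_def raising_index_iff[OF assms] Let_def by (auto simp: Bex_def)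
qed

lemma ftilde_Some_iff:
  assumes "x \<in> Zinf"
  shows "ftilde A lam i x = Some y \<longleftrightarrow> (\<exists>m. lowering_index A lam i x m \<and> y = x(m := x m + 1))"
proof -
  let ?P = "\<lambda>m. m \<in> Mset A lam i x \<and> (\<forall>k\<in>Mset A lam i x. m \<le> k)"
  have "(THE m. ?P m) = m" if "?P m" for m
    using that by (intro the_equality) (auto intro: antisym)
  then show ?thesis
    unfolding ftilde_def lowering_index_iff[OF assms] Let_def by (auto simp: Bex_def)
qed

text \<open>Far to the right \<open>sigma\<close> is 0. A positive value of \<open>sigma\<close> would therefore bound \<open>Mset\<close> from above
  and give it a greatest element. On the other side the constant value of \<open>sigma\<close> far to the left
  takes the place of 0.\<close>

lemma etilde_None_imp:
  assumes x: "x \<in> Zinf" and none: "etilde A lam i x = None" and k: "k \<noteq> 0" "iota k = i"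
  shows "sigma A lam x k \<le> 0"
proof (rule ccontr)
  assume pos: "\<not> ?thesis"
  obtain N where N: "N > 0" "\<And>k. N \<le> k \<Longrightarrow> sigma A lam x k = 0"
    using sigma_far[OF x] by metis
  let ?M = "Mset A lam i x"
  have bound: "j < N" if "j \<in> ?M" for j
    using that pos k N(2)[of j] unfolding Mset_iff[OF x] by force
  obtain j where j: "j \<in> ?M"
    using Mset_nonempty[OF x] by blast
  have fin: "finite (?M \<inter> {j..})"
    by (rule finite_subset[of _ "{j..N}"]) (use bound in force)+
  have "Max (?M \<inter> {j..}) \<in> ?M \<inter> {j..}"
    using fin j by (intro Max_in) auto
  moreover have "l \<le> Max (?M \<inter> {j..})" if "l \<in> ?M" for l
    using Max_ge[OF fin, of l] Max_ge[OF fin, of j] j that by (cases "j \<le> l") auto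
  ultimately have "raising_index A lam i x (Max (?M \<inter> {j..}))"
    unfolding raising_index_iff[OF x] by blast
  then show False
    using none etilde_Some_iff[OF x] by (metis option.distinct(1))
qed

lemma ftilde_None_imp:
  assumes x: "x \<in> Zinf" and none: "ftilde A lam i x = None" and k: "k \<noteq> 0" "iota k = i"
  shows "sigma A lam x k \<le> left_value A lam i x"
proof (rule ccontr)
  assume pos: "\<not> ?thesis"
  obtain N where N: "N > 0"
    "\<And>k. k \<le> - N \<Longrightarrow> sigma A lam x k = left_value A lam (iota k) x"
    using sigma_far[OF x] by metis
  let ?M = "Mset A lam i x"
  have bound: "- N < j" if "j \<in> ?M" for j
    using that pos k N(2)[of j] unfolding Mset_iff[OF x] by force
  obtain j where j: "j \<in> ?M"
    using Mset_nonempty[OF x] by blast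
  have fin: "finite (?M \<inter> {..j})"
    by (rule finite_subset[of _ "{-N..j}"]) (use bound in force)+
  have "Min (?M \<inter> {..j}) \<in> ?M \<inter> {..j}"
    using fin j by (intro Min_in) auto
  moreover have "Min (?M \<inter> {..j}) \<le> l" if "l \<in> ?M" for l
    using Min_le[OF fin, of l] Min_le[OF fin, of j] j that by (cases "l \<le> j") auto
  ultimately have "lowering_index A lam i x (Min (?M \<inter> {..j}))"
    unfolding lowering_index_iff[OF x] by blast
  then show False
    using none ftilde_Some_iff[OF x] by (metis option.distinct(1))
qed

lemma Zinf_update: "x \<in> Zinf \<Longrightarrow> m \<noteq> 0 \<Longrightarrow> x(m := v) \<in> Zinf"
  unfolding Zinf_def
  by (auto intro: finite_subset[of _ "insert m {k. x k \<noteq> 0}"])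

lemma etilde_Zinf:
  assumes "x \<in> Zinf" "etilde A lam i x = Some y"
  shows "y \<in> Zinf"
  using assms Zinf_update by (auto simp: etilde_Some_iff raising_index_def)

lemma ftilde_Zinf:
  assumes "x \<in> Zinf" "ftilde A lam i x = Some y"
  shows "y \<in> Zinf"
  using assms Zinf_update by (auto simp: ftilde_Some_iff lowering_index_def)

text \<open>Lowering \<open>x\<^sub>m\<close> by one lowers \<open>\<sigma>\<^sub>m\<close> by 1 and every \<open>\<sigma>\<^sub>k\<close> of the same colour with \<open>k < m\<close> by 2, and leaves
  those with \<open>k > m\<close>, which were strictly smaller than \<open>\<sigma>\<^sub>m\<close>, unchanged. So the maximum drops by exactly 1, is
  still attained at \<open>m\<close>, and is no longer attained to the left of \<open>m\<close>.\<close>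

lemma ftilde_etilde:
  assumes x: "x \<in> Zinf" and y: "etilde A lam i x = Some y" and A: "A i i = 2"
  shows "ftilde A lam i y = Some x"
proof -
  obtain m where m: "raising_index A lam i x m" "y = x(m := x m + (-1))"
    using y by (auto simp: etilde_Some_iff[OF x])
  have "m \<noteq> 0" "iota m = i"
    using m(1) by (auto simp: raising_index_def)
  then have s: "sigma A lam y k
      = sigma A lam x k + (if k = m then -1 else if k < m then -2 else 0)" if "iota k = i" for k
    using that A sigma_update[OF x, of m A lam "-1" k] m(2) by auto
  have "lowering_index A lam i y m"
    using m(1) unfolding raising_index_def lowering_index_def
    by (smt (verit, best) s)
  moreover have "x = y(m := y m + 1)"
    using m(2) by auto
  ultimately show ?thesis
    using ftilde_Some_iff[OF etilde_Zinf[OF x y]] by blast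
qed

lemma etilde_ftilde:
  assumes x: "x \<in> Zinf" and y: "ftilde A lam i x = Some y" and A: "A i i = 2"
  shows "etilde A lam i y = Some x"
proof -
  obtain m where m: "lowering_index A lam i x m" "y = x(m := x m + 1)"
    using y by (auto simp: ftilde_Some_iff[OF x])
  have "m \<noteq> 0" "iota m = i"
    using m(1) by (auto simp: lowering_index_def)
  then have s: "sigma A lam y k
      = sigma A lam x k + (if k = m then 1 else if k < m then 2 else 0)" if "iota k = i" for k
    using that A sigma_update[OF x, of m A lam 1 k] m(2) by auto
  have "raising_index A lam i y m"
    using m(1) unfolding raising_index_def lowering_index_def
    by (smt (verit, best) s)
  moreover have "x = y(m := y m - 1)"
    using m(2) by auto
  ultimately show ?thesis
    using etilde_Some_iff[OF ftilde_Zinf[OF x y]] by blast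
qed

lemma crystal_edge_sym:
  assumes "\<And>i. A i i = 2" "crystal_edge A lam x y"
  shows "crystal_edge A lam y x"
  using assms ftilde_etilde etilde_ftilde unfolding crystal_edge_def by blast

section \<open>Extremal vectors of a component confined to a stable set\<close>

definition stable :: "(node \<Rightarrow> node \<Rightarrow> int) \<Rightarrow> (node \<Rightarrow> int) \<Rightarrow> (int \<Rightarrow> int) set \<Rightarrow> bool" where
  "stable A lam S \<longleftrightarrow>
     (\<forall>x\<in>S. \<forall>i y. etilde A lam i x = Some y \<or> ftilde A lam i x = Some y \<longrightarrow> y \<in> S)"

text \<open>The equivalence closure also walks along edges backwards; the symmetry of the edge relation turns
  these into forward steps, under which \<open>S\<close> is stable.\<close>

lemma B0_subset_stable:
  assumes "stable A lam S" "(\<lambda>k. 0) \<in> S" "\<And>i. A i i = 2"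
  shows "B0 A lam \<subseteq> S"
proof -
  have "x \<in> S" if "equivclp (crystal_edge A lam) (\<lambda>k. 0) x" for x
    using that
  proof (induction rule: equivclp_induct)
    case base
    then show ?case using assms by simp
  next
    case (step y z)
    then have "crystal_edge A lam y z"
      using crystal_edge_sym[where A = A] assms(3) by blast
    then show ?case
      using step assms(1) unfolding stable_def crystal_edge_def by blast
  qed
  then show ?thesis by (auto simp: B0_def)
qed

lemma B0_etilde:
  assumes "x \<in> B0 A lam" "x \<in> Zinf" "etilde A lam i x = Some y"
  shows "y \<in> B0 A lam"
proof -
  have "crystal_edge A lam x y"
    using assms etilde_Zinf unfolding crystal_edge_def by blast
  then show ?thesis
    using assms(1) equivclp_into_equivclp unfolding B0_def mem_Collect_eq by metis
qed

lemma B0_ftilde: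
  assumes "x \<in> B0 A lam" "x \<in> Zinf" "ftilde A lam i x = Some y"
  shows "y \<in> B0 A lam"
proof -
  have "crystal_edge A lam x y"
    using assms ftilde_Zinf unfolding crystal_edge_def by blast
  then show ?thesis
    using assms(1) equivclp_into_equivclp unfolding B0_def mem_Collect_eq by metis
qed

text \<open>Three coordinates on each side of \<open>t\<^sub>\<lambda>\<close> suffice, as in the longest vectors \<open>H\<^sub>-\<^sub>3\<close> and \<open>L\<^sub>3\<close>.\<close>

definition in_window :: "(int \<Rightarrow> int) \<Rightarrow> bool" where
  "in_window x \<longleftrightarrow> (\<forall>k. k \<notin> {-3, -2, -1, 1, 2, 3} \<longrightarrow> x k = 0)"

definition coord_sum :: "(int \<Rightarrow> int) \<Rightarrow> int" where
  "coord_sum x = x (-3) + x (-2) + x (-1) + x 1 + x 2 + x 3"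

lemma in_window_Zinf: "in_window x \<Longrightarrow> x \<in> Zinf"
  unfolding in_window_def Zinf_def
  by (auto intro!: finite_subset[of _ "{-3, -2, -1, 1, 2, 3}"])

lemma in_window_eqI:
  assumes "in_window x" "in_window y" "x (-3) = y (-3)" "x (-2) = y (-2)" "x (-1) = y (-1)"
    "x 1 = y 1" "x 2 = y 2" "x 3 = y 3"
  shows "x = y"
proof
  show "x k = y k" for k
    using assms unfolding in_window_def by (cases "k \<in> {-3, -2, -1, 1, 2, 3}") auto
qed

lemma coord_sum_update:
  assumes "in_window x" "in_window (x(m := x m + d))"
  shows "coord_sum (x(m := x m + d)) = coord_sum x + d"
proof (cases "m \<in> {-3, -2, -1, 1, 2, 3}")
  case True
  then show ?thesis by (auto simp: coord_sum_def)
next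
  case False
  then have "d = 0"
    using assms unfolding in_window_def by (metis add.left_neutral fun_upd_same)
  then show ?thesis by simp
qed

text \<open>Existence of an extremal vector: an element of the component with least (greatest) coordinate sum
  cannot be moved by \<open>etilde\<close> (\<open>ftilde\<close>), as the result would lie in the component and have a smaller
  (greater) sum.\<close>

lemma extremal_vectors_unique:
  assumes A: "\<And>i. A i i = 2" and st: "stable A lam S" and zero: "(\<lambda>k. 0) \<in> S"
    and window: "\<And>x. x \<in> S \<Longrightarrow> in_window x" and bound: "\<And>x. x \<in> S \<Longrightarrow> \<bar>coord_sum x\<bar> \<le> C"
    and H: "\<And>x. x \<in> S \<Longrightarrow> (\<And>i. etilde A lam i x = None) \<Longrightarrow> x = H"
    and L: "\<And>x. x \<in> S \<Longrightarrow> (\<And>i. ftilde A lam i x = None) \<Longrightarrow> x = L"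
  shows "highest_weight_vectors A lam (B0 A lam) = {H}"
    and "lowest_weight_vectors A lam (B0 A lam) = {L}"
proof -
  have sub: "x \<in> S" if "x \<in> B0 A lam" for x
    using B0_subset_stable[where A = A and S = S and lam = lam, OF st zero A] that by (rule subsetD)
  have zero_B0: "(\<lambda>k. 0) \<in> B0 A lam"
    by (simp add: B0_def)
  obtain h where h: "h \<in> B0 A lam"
    and h_min: "\<And>y. y \<in> B0 A lam \<Longrightarrow> nat (coord_sum h + C) \<le> nat (coord_sum y + C)"
    using ex_has_least_nat[of "\<lambda>x. x \<in> B0 A lam" _ "\<lambda>x. nat (coord_sum x + C)", OF zero_B0] by metis
  have h_None: "etilde A lam i h = None" for i
  proof (cases "etilde A lam i h")
    case (Some y)
    note h_Z = in_window_Zinf[OF window[OF sub[OF h]]]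
    have yB: "y \<in> B0 A lam"
      by (rule B0_etilde[OF h h_Z Some])
    obtain m where m: "y = h(m := h m + (-1))"
      using Some by (auto simp: etilde_Some_iff[OF h_Z])
    have "coord_sum y = coord_sum h + (-1)"
      unfolding m by (rule coord_sum_update) (use window[OF sub[OF h]] window[OF sub[OF yB]] m in simp_all)
    then have False
      using h_min[OF yB] bound[OF sub[OF yB]] by linarith
    then show ?thesis ..
  qed
  show "highest_weight_vectors A lam (B0 A lam) = {H}"
  proof (intro equalityI subsetI)
    show "x \<in> {H}" if "x \<in> highest_weight_vectors A lam (B0 A lam)" for x
      using that H[OF sub, of x] unfolding highest_weight_vectors_def by simp
    show "x \<in> highest_weight_vectors A lam (B0 A lam)" if "x \<in> {H}" for x
      using that h h_None H[OF sub[OF h] h_None] unfolding highest_weight_vectors_def by simp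
  qed
  obtain l where l: "l \<in> B0 A lam"
    and l_max: "\<And>y. y \<in> B0 A lam \<Longrightarrow> nat (C - coord_sum l) \<le> nat (C - coord_sum y)"
    using ex_has_least_nat[of "\<lambda>x. x \<in> B0 A lam" _ "\<lambda>x. nat (C - coord_sum x)", OF zero_B0] by metis
  have l_None: "ftilde A lam i l = None" for i
  proof (cases "ftilde A lam i l")
    case (Some y)
    note l_Z = in_window_Zinf[OF window[OF sub[OF l]]]
    have yB: "y \<in> B0 A lam"
      by (rule B0_ftilde[OF l l_Z Some])
    obtain m where m: "y = l(m := l m + 1)"
      using Some by (auto simp: ftilde_Some_iff[OF l_Z])
    have "coord_sum y = coord_sum l + 1"
      unfolding m by (rule coord_sum_update) (use window[OF sub[OF l]] window[OF sub[OF yB]] m in simp_all)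
    then have False
      using l_max[OF yB] bound[OF sub[OF yB]] by linarith
    then show ?thesis ..
  qed
  show "lowest_weight_vectors A lam (B0 A lam) = {L}"
  proof (intro equalityI subsetI)
    show "x \<in> {L}" if "x \<in> lowest_weight_vectors A lam (B0 A lam)" for x
      using that L[OF sub, of x] unfolding lowest_weight_vectors_def by simp
    show "x \<in> lowest_weight_vectors A lam (B0 A lam)" if "x \<in> {L}" for x
      using that l l_None L[OF sub[OF l] l_None] unfolding lowest_weight_vectors_def by simp
  qed
qed


section \<open>Evaluation on sequences supported near the origin\<close>

lemma sigma_in_window:
  assumes "in_window x"
  shows "sigma A lam x k = (if k < 0 then - lam (iota k) else 0) + x k
     + (\<Sum>j\<in>{-3, -2, -1, 1, 2, 3}. if k < j then A (iota k) (iota j) * x j else 0)"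
proof -
  have "{j. x j \<noteq> 0} \<subseteq> {-3, -2, -1, 1, 2, 3}"
    using assms unfolding in_window_def by blast
  then show ?thesis
    using sigma_finite_support[of "{-3, -2, -1, 1, 2, 3}" x A lam k] by simp
qed

lemma sigma_right:
  assumes "in_window x" "3 < k"
  shows "sigma A lam x k = 0"
proof -
  have "x k = 0"
    using assms unfolding in_window_def by force
  then show ?thesis
    using assms(2) sigma_in_window[OF assms(1)] by simp
qed

lemma sigma_left:
  assumes "in_window x" "k < -3"
  shows "sigma A lam x k = left_value A lam (iota k) x"
proof -
  have *: "x j \<noteq> 0 \<Longrightarrow> j \<in> {-3, -2, -1, 1, 2, 3}" for j
    using assms(1) unfolding in_window_def by blast
  have "x k = 0"
    using *[of k] assms(2) by force
  moreover have "{j. k < j \<and> j \<noteq> 0 \<and> x j \<noteq> 0} = {j. x j \<noteq> 0}"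
    using * assms(2) by force
  ultimately show ?thesis
    using assms(2) unfolding sigma_def left_value_def by simp
qed

lemma sigma_values:
  assumes "in_window x"
  shows "sigma (cartan 2 1) lam x 5 = 0"
    "sigma (cartan 2 1) lam x 3 = x 3"
    "sigma (cartan 2 1) lam x 1 = x 1 - 2 * x 2 + 2 * x 3"
    "sigma (cartan 2 1) lam x (-2) = - lam N1 + x (-2) - 2 * x (-1) + 2 * x 1 - 2 * x 2 + 2 * x 3"
    "sigma (cartan 2 1) lam x (-4) =
       - lam N1 - 2 * x (-3) + 2 * x (-2) - 2 * x (-1) + 2 * x 1 - 2 * x 2 + 2 * x 3"
    "sigma (cartan 2 1) lam x 4 = 0"
    "sigma (cartan 2 1) lam x 2 = x 2 - x 3"
    "sigma (cartan 2 1) lam x (-1) = - lam N2 + x (-1) - x 1 + 2 * x 2 - x 3"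
    "sigma (cartan 2 1) lam x (-3) = - lam N2 + x (-3) - x (-2) + 2 * x (-1) - x 1 + 2 * x 2 - x 3"
    "sigma (cartan 2 1) lam x (-5) =
       - lam N2 + 2 * x (-3) - x (-2) + 2 * x (-1) - x 1 + 2 * x 2 - x 3"
proof -
  have "x (-4) = 0" "x (-5) = 0" "x 4 = 0" "x 5 = 0"
    using assms by (simp_all add: in_window_def)
  then show "sigma (cartan 2 1) lam x 5 = 0"
    "sigma (cartan 2 1) lam x 3 = x 3"
    "sigma (cartan 2 1) lam x 1 = x 1 - 2 * x 2 + 2 * x 3"
    "sigma (cartan 2 1) lam x (-2) = - lam N1 + x (-2) - 2 * x (-1) + 2 * x 1 - 2 * x 2 + 2 * x 3"
    "sigma (cartan 2 1) lam x (-4) =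
       - lam N1 - 2 * x (-3) + 2 * x (-2) - 2 * x (-1) + 2 * x 1 - 2 * x 2 + 2 * x 3"
    "sigma (cartan 2 1) lam x 4 = 0"
    "sigma (cartan 2 1) lam x 2 = x 2 - x 3"
    "sigma (cartan 2 1) lam x (-1) = - lam N2 + x (-1) - x 1 + 2 * x 2 - x 3"
    "sigma (cartan 2 1) lam x (-3) = - lam N2 + x (-3) - x (-2) + 2 * x (-1) - x 1 + 2 * x 2 - x 3"
    "sigma (cartan 2 1) lam x (-5) =
       - lam N2 + 2 * x (-3) - x (-2) + 2 * x (-1) - x 1 + 2 * x 2 - x 3"
    by (simp_all add: sigma_in_window[OF assms] iota_def)
qed

text \<open>The indices of colour \<open>i\<close> at which \<open>sigma\<close> has to be evaluated: those in the window, and on either side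
  one further index representing the values beyond it, where \<open>sigma\<close> is constant on the colour.\<close>

fun window_indices :: "node \<Rightarrow> int set" where
  "window_indices N1 = {-4, -2, 1, 3, 5}"
| "window_indices N2 = {-5, -3, -1, 2, 4}"

lemma window_indices_coloured: "k \<in> window_indices i \<Longrightarrow> k \<noteq> 0 \<and> iota k = i"
  by (cases i) (auto simp: iota_def)

lemma window_indices_small:
  assumes "k \<noteq> 0" "iota k = i" "-6 < k" "k < 4"
  shows "k \<in> window_indices i"
proof -
  have "k \<in> {-5, -4, -3, -2, -1, 1, 2, 3}"
    using assms by auto
  then show ?thesis
    using assms(2) by (auto simp: iota_def)
qed

text \<open>Two indices of the same colour beyond the same end of the window have equal \<open>sigma\<close>, so the strict
  inequality in the selection rule leaves on the left only the index closest to the window, and none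
  on the right. For \<open>ftilde\<close> the two ends are exchanged.\<close>

lemma raising_index_in_window:
  assumes "in_window x" "raising_index A lam i x m"
  shows "m \<in> window_indices i" "m < 4"
proof -
  have m: "m \<noteq> 0" "iota m = i"
    and max: "\<And>k. k \<noteq> 0 \<Longrightarrow> iota k = i \<Longrightarrow> m < k \<Longrightarrow> sigma A lam x k < sigma A lam x m"
    using assms(2) by (auto simp: raising_index_def)
  have shift: "iota (m + 2) = i" if "m < -5 \<or> 3 < m"
    using m(2) that by (auto simp: iota_def)
  show "m < 4"
  proof (rule ccontr)
    assume "\<not> m < 4"
    then show False
      using max[of "m + 2"] shift sigma_right[OF assms(1), of m] sigma_right[OF assms(1), of "m + 2"]
      by simp
  qed
  moreover have "-6 < m"
  proof (rule ccontr)
    assume "\<not> -6 < m"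
    then show False
      using max[of "m + 2"] shift m sigma_left[OF assms(1), of m] sigma_left[OF assms(1), of "m + 2"]
      by simp
  qed
  ultimately show "m \<in> window_indices i"
    using m window_indices_small by simp
qed

lemma lowering_index_in_window:
  assumes "in_window x" "lowering_index A lam i x m"
  shows "m \<in> window_indices i" "-4 < m"
proof -
  have m: "m \<noteq> 0" "iota m = i"
    and max: "\<And>k. k \<noteq> 0 \<Longrightarrow> iota k = i \<Longrightarrow> k < m \<Longrightarrow> sigma A lam x k < sigma A lam x m"
    using assms(2) by (auto simp: lowering_index_def)
  have shift: "iota (m - 2) = i" if "m < -3 \<or> 5 < m"
    using m(2) that by (auto simp: iota_def)
  have low: "-4 < m"
  proof (rule ccontr)
    assume "\<not> -4 < m"
    then show False
      using max[of "m - 2"] shift m sigma_left[OF assms(1), of m] sigma_left[OF assms(1), of "m - 2"]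
      by simp
  qed
  have high: "m < 6"
  proof (rule ccontr)
    assume "\<not> m < 6"
    then show False
      using max[of "m - 2"] shift sigma_right[OF assms(1), of m] sigma_right[OF assms(1), of "m - 2"]
      by simp
  qed
  have "m \<in> {-3, -2, -1, 1, 2, 3, 4, 5}"
    using low high m(1) by auto
  then show "m \<in> window_indices i"
    using m(2) by (auto simp: iota_def)
  show "-4 < m"
    by (fact low)
qed

lemma stable_windowI:
  assumes window: "\<And>x. x \<in> S \<Longrightarrow> in_window x"
    and e: "\<And>x i m. \<lbrakk>x \<in> S; m \<in> window_indices i; m < 4;
        \<forall>k\<in>window_indices i. sigma A lam x k \<le> sigma A lam x m \<and> (m < k \<longrightarrow> sigma A lam x k < sigma A lam x m)\<rbrakk>
      \<Longrightarrow> x(m := x m - 1) \<in> S"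
    and f: "\<And>x i m. \<lbrakk>x \<in> S; m \<in> window_indices i; -4 < m;
        \<forall>k\<in>window_indices i. sigma A lam x k \<le> sigma A lam x m \<and> (k < m \<longrightarrow> sigma A lam x k < sigma A lam x m)\<rbrakk>
      \<Longrightarrow> x(m := x m + 1) \<in> S"
  shows "stable A lam S"
  unfolding stable_def
proof (intro ballI allI impI)
  fix x i y
  assume x: "x \<in> S" and "etilde A lam i x = Some y \<or> ftilde A lam i x = Some y"
  note xw = window[OF x]
  from \<open>_ \<or> _\<close> show "y \<in> S"
  proof
    assume "etilde A lam i x = Some y"
    then obtain m where m: "raising_index A lam i x m" and y: "y = x(m := x m - 1)"
      unfolding etilde_Some_iff[OF in_window_Zinf[OF xw]] by (elim exE conjE)
    show "y \<in> S"
      unfolding y using m window_indices_coloured raising_index_in_window[OF xw m]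
      by (intro e[OF x, of _ i]) (auto simp: raising_index_def)
  next
    assume "ftilde A lam i x = Some y"
    then obtain m where m: "lowering_index A lam i x m" and y: "y = x(m := x m + 1)"
      unfolding ftilde_Some_iff[OF in_window_Zinf[OF xw]] by (elim exE conjE)
    show "y \<in> S"
      unfolding y using m window_indices_coloured lowering_index_in_window[OF xw m]
      by (intro f[OF x, of _ i]) (auto simp: lowering_index_def)
  qed
qed

lemma highest_window:
  assumes "in_window x" "etilde A lam i x = None" "k \<in> window_indices i"
  shows "sigma A lam x k \<le> 0"
  using etilde_None_imp[OF in_window_Zinf[OF assms(1)] assms(2)] window_indices_coloured[OF assms(3)] by blast

lemma lowest_window:
  assumes "in_window x" "ftilde A lam i x = None" "k \<in> window_indices i"
  shows "sigma A lam x k \<le> sigma A lam x (case i of N1 \<Rightarrow> -4 | N2 \<Rightarrow> -5)"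
proof -
  have "sigma A lam x (case i of N1 \<Rightarrow> -4 | N2 \<Rightarrow> -5) = left_value A lam i x"
    using sigma_left[OF assms(1), of "-4"] sigma_left[OF assms(1), of "-5"]
    by (cases i) (simp_all add: iota_def)
  then show ?thesis
    using ftilde_None_imp[OF in_window_Zinf[OF assms(1)] assms(2)] window_indices_coloured[OF assms(3)] by simp
qed

lemma in_window_update: "in_window x \<Longrightarrow> m \<in> {-3, -2, -1, 1, 2, 3} \<Longrightarrow> in_window (x(m := v))"
  unfolding in_window_def by auto

section \<open>The three stable polytopes\<close>

text \<open>For \<open>\<lambda>\<close> in the three chambers \<open>s\<^sub>2 C\<close>, \<open>s\<^sub>2 s\<^sub>1 C\<close> and \<open>s\<^sub>2 s\<^sub>1 s\<^sub>2 C\<close> (\<open>C\<close> the closed dominant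
  chamber) the four coordinates left free are consecutive ones, and each further reflection moves
  them one step towards the negative indices. The inequalities are such
  that, whenever a step would violate one of them, a comparison of values of \<open>sigma\<close> forbids the
  step. In the first polytope, for instance, \<open>e\<^sub>1\<close> acts on \<open>x\<^sub>1\<close> only if \<open>\<sigma>\<^sub>1 > \<sigma>\<^sub>3\<close>, that is
  \<open>x\<^sub>1 - x\<^sub>2 > x\<^sub>2 - x\<^sub>3\<close>, and since \<open>x\<^sub>2 \<ge> x\<^sub>3\<close> the inequality \<open>x\<^sub>1 \<ge> x\<^sub>2\<close> survives; \<open>e\<^sub>1\<close> acts on \<open>x\<^sub>3\<close> only
  if \<open>\<sigma>\<^sub>3 = x\<^sub>3\<close> exceeds \<open>\<sigma>\<^sub>5 = 0\<close>; and \<open>x\<^sub>1 \<le> \<lambda>\<^sub>1 + 2 x\<^sub>-\<^sub>1\<close> says that \<open>\<sigma>\<^sub>-\<^sub>2 \<le> \<sigma>\<^sub>1\<close>, so that \<open>e\<^sub>1\<close> never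
  selects the coordinate \<open>x\<^sub>-\<^sub>2\<close>, which is 0 on this polytope.\<close>

definition polytope_s2 :: "(node \<Rightarrow> int) \<Rightarrow> (int \<Rightarrow> int) set" where
  "polytope_s2 lam = {x. in_window x \<and> x (-3) = 0 \<and> x (-2) = 0 \<and> lam N2 \<le> x (-1) \<and>
     x (-1) \<le> 0 \<and> x 1 \<le> lam N1 + 2 * x (-1) \<and>
     2 * x 2 - x 1 \<le> lam N1 + 2 * lam N2 \<and> x 2 \<le> x 1 \<and>
     x 3 \<le> x 2 \<and> 0 \<le> x 3 \<and> x 3 \<le> lam N1 + 2 * lam N2}"

lemma stable_polytope_s2:
  assumes "lam N1 > 0" "lam N2 < 0" "- 2 * lam N2 \<le> lam N1"
  shows "stable (cartan 2 1) lam (polytope_s2 lam)"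
proof (rule stable_windowI)
  fix x i m
  assume x: "x \<in> polytope_s2 lam"
  then have w: "in_window x"
    by (simp add: polytope_s2_def)
  have ineqs: "x (-3) = 0" "x (-2) = 0" "lam N2 \<le> x (-1)" "x (-1) \<le> 0"
      "x 1 \<le> lam N1 + 2 * x (-1)" "2 * x 2 - x 1 \<le> lam N1 + 2 * lam N2"
      "x 2 \<le> x 1" "x 3 \<le> x 2" "0 \<le> x 3" "x 3 \<le> lam N1 + 2 * lam N2"
    using x by (simp_all add: polytope_s2_def)
  show "x(m := x m - 1) \<in> polytope_s2 lam" if m: "m \<in> window_indices i" "m < 4"
    and max: "\<forall>k\<in>window_indices i. sigma (cartan 2 1) lam x k \<le> sigma (cartan 2 1) lam x m \<and>
       (m < k \<longrightarrow> sigma (cartan 2 1) lam x k < sigma (cartan 2 1) lam x m)"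
  proof (cases i)
    case N1
    then have "m = -4 \<or> m = -2 \<or> m = 1 \<or> m = 3"
      using m by auto
    then show ?thesis
      by (elim disjE; hypsubst)
        (use max N1 ineqs assms in \<open>simp_all add: sigma_values[OF w]
          polytope_s2_def in_window_update[OF w]\<close>)
  next
    case N2
    then have "m = -5 \<or> m = -3 \<or> m = -1 \<or> m = 2"
      using m by auto
    then show ?thesis
      by (elim disjE; hypsubst)
        (use max N2 ineqs assms in \<open>simp_all add: sigma_values[OF w]
          polytope_s2_def in_window_update[OF w]\<close>)
  qed
  show "x(m := x m + 1) \<in> polytope_s2 lam" if m: "m \<in> window_indices i" "-4 < m"
    and max: "\<forall>k\<in>window_indices i. sigma (cartan 2 1) lam x k \<le> sigma (cartan 2 1) lam x m \<and>
       (k < m \<longrightarrow> sigma (cartan 2 1) lam x k < sigma (cartan 2 1) lam x m)"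
  proof (cases i)
    case N1
    then have "m = -2 \<or> m = 1 \<or> m = 3 \<or> m = 5"
      using m by auto
    then show ?thesis
      by (elim disjE; hypsubst)
        (use max N1 ineqs assms in \<open>simp_all add: sigma_values[OF w]
          polytope_s2_def in_window_update[OF w]\<close>)
  next
    case N2
    then have "m = -3 \<or> m = -1 \<or> m = 2 \<or> m = 4"
      using m by auto
    then show ?thesis
      by (elim disjE; hypsubst)
        (use max N2 ineqs assms in \<open>simp_all add: sigma_values[OF w]
          polytope_s2_def in_window_update[OF w]\<close>)
  qed
qed (simp add: polytope_s2_def)

lemma extremal_polytope_s2:
  assumes "lam N1 > 0" "lam N2 < 0" "- 2 * lam N2 \<le> lam N1"
  shows "highest_weight_vectors (cartan 2 1) lam (B0 (cartan 2 1) lam) = {Hvec lam 1}"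
    and "lowest_weight_vectors (cartan 2 1) lam (B0 (cartan 2 1) lam) = {Lvec lam 3}"
proof -
  have A: "cartan 2 1 i i = 2" for i
    by (cases i) simp_all
  have zero: "(\<lambda>k. 0) \<in> polytope_s2 lam"
    using assms by (simp add: polytope_s2_def in_window_def)
  have window: "in_window x" if "x \<in> polytope_s2 lam" for x
    using that by (simp add: polytope_s2_def)
  have bound: "\<bar>coord_sum x\<bar> \<le> 4 * lam N1 - 4 * lam N2" if "x \<in> polytope_s2 lam" for x
    using that assms by (simp add: polytope_s2_def coord_sum_def abs_le_iff)
  have H: "x = Hvec lam 1"
    if x: "x \<in> polytope_s2 lam" and none: "\<And>i. etilde (cartan 2 1) lam i x = None" for x
  proof (rule in_window_eqI[OF window[OF x]])
    have le: "\<forall>k\<in>window_indices i. sigma (cartan 2 1) lam x k \<le> 0" for i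
      using highest_window[OF window[OF x] none] by blast
    show "in_window (Hvec lam 1)"
      by (auto simp: in_window_def Hvec_def)
    show "x (-3) = Hvec lam 1 (-3)" "x (-2) = Hvec lam 1 (-2)" "x (-1) = Hvec lam 1 (-1)"
      "x 1 = Hvec lam 1 1" "x 2 = Hvec lam 1 2" "x 3 = Hvec lam 1 3"
      using x assms le[of N1] le[of N2]
      by (simp_all add: polytope_s2_def sigma_values[OF window[OF x]]
          Hvec_def h_coord_def a_coef_def a'_coef_def)
  qed
  have L: "x = Lvec lam 3"
    if x: "x \<in> polytope_s2 lam" and none: "\<And>i. ftilde (cartan 2 1) lam i x = None" for x
  proof (rule in_window_eqI[OF window[OF x]])
    have le: "\<forall>k\<in>window_indices i. sigma (cartan 2 1) lam x k
        \<le> sigma (cartan 2 1) lam x (case i of N1 \<Rightarrow> -4 | N2 \<Rightarrow> -5)" for i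
      using lowest_window[OF window[OF x] none] by blast
    show "in_window (Lvec lam 3)"
      by (auto simp: in_window_def Lvec_def)
    show "x (-3) = Lvec lam 3 (-3)" "x (-2) = Lvec lam 3 (-2)" "x (-1) = Lvec lam 3 (-1)"
      "x 1 = Lvec lam 3 1" "x 2 = Lvec lam 3 2" "x 3 = Lvec lam 3 3"
      using x assms le[of N1] le[of N2]
      by (simp_all add: polytope_s2_def sigma_values[OF window[OF x]]
          Lvec_def l_coord_def a_coef_def a'_coef_def)
  qed
  show "highest_weight_vectors (cartan 2 1) lam (B0 (cartan 2 1) lam) = {Hvec lam 1}"
    "lowest_weight_vectors (cartan 2 1) lam (B0 (cartan 2 1) lam) = {Lvec lam 3}"
    using extremal_vectors_unique[where A = "cartan 2 1" and S = "polytope_s2 lam",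
        OF A stable_polytope_s2[OF assms] zero window bound H L] by blast+
qed

definition polytope_s2s1 :: "(node \<Rightarrow> int) \<Rightarrow> (int \<Rightarrow> int) set" where
  "polytope_s2s1 lam = {x. in_window x \<and> x (-3) = 0 \<and> x 3 = 0 \<and>
     lam N1 + 2 * lam N2 \<le> x (-2) \<and> x (-2) \<le> 0 \<and>
     x (-1) \<le> x (-2) \<and> x 1 - 2 * x (-1) \<le> - 2 * lam N2 \<and>
     x 1 - x (-1) \<le> lam N1 \<and> 2 * x 2 \<le> x 1 \<and> 0 \<le> x 2 \<and>
     x 2 \<le> lam N1 + lam N2}"

lemma stable_polytope_s2s1:
  assumes "lam N1 > 0" "lam N2 < 0" "- lam N2 \<le> lam N1" "lam N1 \<le> - 2 * lam N2"
  shows "stable (cartan 2 1) lam (polytope_s2s1 lam)"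
proof (rule stable_windowI)
  fix x i m
  assume x: "x \<in> polytope_s2s1 lam"
  then have w: "in_window x"
    by (simp add: polytope_s2s1_def)
  have ineqs: "x (-3) = 0" "x 3 = 0" "lam N1 + 2 * lam N2 \<le> x (-2)" "x (-2) \<le> 0"
      "x (-1) \<le> x (-2)" "x 1 - 2 * x (-1) \<le> - 2 * lam N2"
      "x 1 - x (-1) \<le> lam N1" "2 * x 2 \<le> x 1" "0 \<le> x 2"
      "x 2 \<le> lam N1 + lam N2"
    using x by (simp_all add: polytope_s2s1_def)
  show "x(m := x m - 1) \<in> polytope_s2s1 lam" if m: "m \<in> window_indices i" "m < 4"
    and max: "\<forall>k\<in>window_indices i. sigma (cartan 2 1) lam x k \<le> sigma (cartan 2 1) lam x m \<and>
       (m < k \<longrightarrow> sigma (cartan 2 1) lam x k < sigma (cartan 2 1) lam x m)"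
  proof (cases i)
    case N1
    then have "m = -4 \<or> m = -2 \<or> m = 1 \<or> m = 3"
      using m by auto
    then show ?thesis
      by (elim disjE; hypsubst)
        (use max N1 ineqs assms in \<open>simp_all add: sigma_values[OF w]
          polytope_s2s1_def in_window_update[OF w]\<close>)
  next
    case N2
    then have "m = -5 \<or> m = -3 \<or> m = -1 \<or> m = 2"
      using m by auto
    then show ?thesis
      by (elim disjE; hypsubst)
        (use max N2 ineqs assms in \<open>simp_all add: sigma_values[OF w]
          polytope_s2s1_def in_window_update[OF w]\<close>)
  qed
  show "x(m := x m + 1) \<in> polytope_s2s1 lam" if m: "m \<in> window_indices i" "-4 < m"
    and max: "\<forall>k\<in>window_indices i. sigma (cartan 2 1) lam x k \<le> sigma (cartan 2 1) lam x m \<and>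
       (k < m \<longrightarrow> sigma (cartan 2 1) lam x k < sigma (cartan 2 1) lam x m)"
  proof (cases i)
    case N1
    then have "m = -2 \<or> m = 1 \<or> m = 3 \<or> m = 5"
      using m by auto
    then show ?thesis
      by (elim disjE; hypsubst)
        (use max N1 ineqs assms in \<open>simp_all add: sigma_values[OF w]
          polytope_s2s1_def in_window_update[OF w]\<close>)
  next
    case N2
    then have "m = -3 \<or> m = -1 \<or> m = 2 \<or> m = 4"
      using m by auto
    then show ?thesis
      by (elim disjE; hypsubst)
        (use max N2 ineqs assms in \<open>simp_all add: sigma_values[OF w]
          polytope_s2s1_def in_window_update[OF w]\<close>)
  qed
qed (simp add: polytope_s2s1_def)

lemma extremal_polytope_s2s1:
  assumes "lam N1 > 0" "lam N2 < 0" "- lam N2 \<le> lam N1" "lam N1 \<le> - 2 * lam N2"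
  shows "highest_weight_vectors (cartan 2 1) lam (B0 (cartan 2 1) lam) = {Hvec lam 2}"
    and "lowest_weight_vectors (cartan 2 1) lam (B0 (cartan 2 1) lam) = {Lvec lam 2}"
proof -
  have A: "cartan 2 1 i i = 2" for i
    by (cases i) simp_all
  have zero: "(\<lambda>k. 0) \<in> polytope_s2s1 lam"
    using assms by (simp add: polytope_s2s1_def in_window_def)
  have window: "in_window x" if "x \<in> polytope_s2s1 lam" for x
    using that by (simp add: polytope_s2s1_def)
  have bound: "\<bar>coord_sum x\<bar> \<le> 4 * lam N1 - 4 * lam N2" if "x \<in> polytope_s2s1 lam" for x
    using that assms by (simp add: polytope_s2s1_def coord_sum_def abs_le_iff)
  have H: "x = Hvec lam 2"
    if x: "x \<in> polytope_s2s1 lam" and none: "\<And>i. etilde (cartan 2 1) lam i x = None" for x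
  proof (rule in_window_eqI[OF window[OF x]])
    have le: "\<forall>k\<in>window_indices i. sigma (cartan 2 1) lam x k \<le> 0" for i
      using highest_window[OF window[OF x] none] by blast
    show "in_window (Hvec lam 2)"
      by (auto simp: in_window_def Hvec_def)
    show "x (-3) = Hvec lam 2 (-3)" "x (-2) = Hvec lam 2 (-2)" "x (-1) = Hvec lam 2 (-1)"
      "x 1 = Hvec lam 2 1" "x 2 = Hvec lam 2 2" "x 3 = Hvec lam 2 3"
      using x assms le[of N1] le[of N2]
      by (simp_all add: polytope_s2s1_def sigma_values[OF window[OF x]]
          Hvec_def h_coord_def a_coef_def a'_coef_def)
  qed
  have L: "x = Lvec lam 2"
    if x: "x \<in> polytope_s2s1 lam" and none: "\<And>i. ftilde (cartan 2 1) lam i x = None" for x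
  proof (rule in_window_eqI[OF window[OF x]])
    have le: "\<forall>k\<in>window_indices i. sigma (cartan 2 1) lam x k
        \<le> sigma (cartan 2 1) lam x (case i of N1 \<Rightarrow> -4 | N2 \<Rightarrow> -5)" for i
      using lowest_window[OF window[OF x] none] by blast
    show "in_window (Lvec lam 2)"
      by (auto simp: in_window_def Lvec_def)
    show "x (-3) = Lvec lam 2 (-3)" "x (-2) = Lvec lam 2 (-2)" "x (-1) = Lvec lam 2 (-1)"
      "x 1 = Lvec lam 2 1" "x 2 = Lvec lam 2 2" "x 3 = Lvec lam 2 3"
      using x assms le[of N1] le[of N2]
      by (simp_all add: polytope_s2s1_def sigma_values[OF window[OF x]]
          Lvec_def l_coord_def a_coef_def a'_coef_def)
  qed
  show "highest_weight_vectors (cartan 2 1) lam (B0 (cartan 2 1) lam) = {Hvec lam 2}"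
    "lowest_weight_vectors (cartan 2 1) lam (B0 (cartan 2 1) lam) = {Lvec lam 2}"
    using extremal_vectors_unique[where A = "cartan 2 1" and S = "polytope_s2s1 lam",
        OF A stable_polytope_s2s1[OF assms] zero window bound H L] by blast+
qed

definition polytope_s2s1s2 :: "(node \<Rightarrow> int) \<Rightarrow> (int \<Rightarrow> int) set" where
  "polytope_s2s1s2 lam = {x. in_window x \<and> x 2 = 0 \<and> x 3 = 0 \<and> lam N1 + lam N2 \<le> x (-3) \<and>
     x (-3) \<le> 0 \<and> x (-2) \<le> 2 * x (-3) \<and>
     x (-1) - x (-2) \<le> - lam N2 - lam N1 \<and> 2 * x (-1) \<le> x (-2) \<and>
     x 1 - x (-1) \<le> - lam N2 \<and> 0 \<le> x 1 \<and> x 1 \<le> lam N1}"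

lemma stable_polytope_s2s1s2:
  assumes "lam N1 > 0" "lam N2 < 0" "lam N1 \<le> - lam N2"
  shows "stable (cartan 2 1) lam (polytope_s2s1s2 lam)"
proof (rule stable_windowI)
  fix x i m
  assume x: "x \<in> polytope_s2s1s2 lam"
  then have w: "in_window x"
    by (simp add: polytope_s2s1s2_def)
  have ineqs: "x 2 = 0" "x 3 = 0" "lam N1 + lam N2 \<le> x (-3)" "x (-3) \<le> 0"
      "x (-2) \<le> 2 * x (-3)" "x (-1) - x (-2) \<le> - lam N2 - lam N1"
      "2 * x (-1) \<le> x (-2)" "x 1 - x (-1) \<le> - lam N2" "0 \<le> x 1"
      "x 1 \<le> lam N1"
    using x by (simp_all add: polytope_s2s1s2_def)
  show "x(m := x m - 1) \<in> polytope_s2s1s2 lam" if m: "m \<in> window_indices i" "m < 4"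
    and max: "\<forall>k\<in>window_indices i. sigma (cartan 2 1) lam x k \<le> sigma (cartan 2 1) lam x m \<and>
       (m < k \<longrightarrow> sigma (cartan 2 1) lam x k < sigma (cartan 2 1) lam x m)"
  proof (cases i)
    case N1
    then have "m = -4 \<or> m = -2 \<or> m = 1 \<or> m = 3"
      using m by auto
    then show ?thesis
      by (elim disjE; hypsubst)
        (use max N1 ineqs assms in \<open>simp_all add: sigma_values[OF w]
          polytope_s2s1s2_def in_window_update[OF w]\<close>)
  next
    case N2
    then have "m = -5 \<or> m = -3 \<or> m = -1 \<or> m = 2"
      using m by auto
    then show ?thesis
      by (elim disjE; hypsubst)
        (use max N2 ineqs assms in \<open>simp_all add: sigma_values[OF w]
          polytope_s2s1s2_def in_window_update[OF w]\<close>)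
  qed
  show "x(m := x m + 1) \<in> polytope_s2s1s2 lam" if m: "m \<in> window_indices i" "-4 < m"
    and max: "\<forall>k\<in>window_indices i. sigma (cartan 2 1) lam x k \<le> sigma (cartan 2 1) lam x m \<and>
       (k < m \<longrightarrow> sigma (cartan 2 1) lam x k < sigma (cartan 2 1) lam x m)"
  proof (cases i)
    case N1
    then have "m = -2 \<or> m = 1 \<or> m = 3 \<or> m = 5"
      using m by auto
    then show ?thesis
      by (elim disjE; hypsubst)
        (use max N1 ineqs assms in \<open>simp_all add: sigma_values[OF w]
          polytope_s2s1s2_def in_window_update[OF w]\<close>)
  next
    case N2
    then have "m = -3 \<or> m = -1 \<or> m = 2 \<or> m = 4"
      using m by auto
    then show ?thesis
      by (elim disjE; hypsubst)
        (use max N2 ineqs assms in \<open>simp_all add: sigma_values[OF w]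
          polytope_s2s1s2_def in_window_update[OF w]\<close>)
  qed
qed (simp add: polytope_s2s1s2_def)

lemma extremal_polytope_s2s1s2:
  assumes "lam N1 > 0" "lam N2 < 0" "lam N1 \<le> - lam N2"
  shows "highest_weight_vectors (cartan 2 1) lam (B0 (cartan 2 1) lam) = {Hvec lam 3}"
    and "lowest_weight_vectors (cartan 2 1) lam (B0 (cartan 2 1) lam) = {Lvec lam 1}"
proof -
  have A: "cartan 2 1 i i = 2" for i
    by (cases i) simp_all
  have zero: "(\<lambda>k. 0) \<in> polytope_s2s1s2 lam"
    using assms by (simp add: polytope_s2s1s2_def in_window_def)
  have window: "in_window x" if "x \<in> polytope_s2s1s2 lam" for x
    using that by (simp add: polytope_s2s1s2_def)
  have bound: "\<bar>coord_sum x\<bar> \<le> 4 * lam N1 - 4 * lam N2" if "x \<in> polytope_s2s1s2 lam" for x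
    using that assms by (simp add: polytope_s2s1s2_def coord_sum_def abs_le_iff)
  have H: "x = Hvec lam 3"
    if x: "x \<in> polytope_s2s1s2 lam" and none: "\<And>i. etilde (cartan 2 1) lam i x = None" for x
  proof (rule in_window_eqI[OF window[OF x]])
    have le: "\<forall>k\<in>window_indices i. sigma (cartan 2 1) lam x k \<le> 0" for i
      using highest_window[OF window[OF x] none] by blast
    show "in_window (Hvec lam 3)"
      by (auto simp: in_window_def Hvec_def)
    show "x (-3) = Hvec lam 3 (-3)" "x (-2) = Hvec lam 3 (-2)" "x (-1) = Hvec lam 3 (-1)"
      "x 1 = Hvec lam 3 1" "x 2 = Hvec lam 3 2" "x 3 = Hvec lam 3 3"
      using x assms le[of N1] le[of N2]
      by (simp_all add: polytope_s2s1s2_def sigma_values[OF window[OF x]]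
          Hvec_def h_coord_def a_coef_def a'_coef_def)
  qed
  have L: "x = Lvec lam 1"
    if x: "x \<in> polytope_s2s1s2 lam" and none: "\<And>i. ftilde (cartan 2 1) lam i x = None" for x
  proof (rule in_window_eqI[OF window[OF x]])
    have le: "\<forall>k\<in>window_indices i. sigma (cartan 2 1) lam x k
        \<le> sigma (cartan 2 1) lam x (case i of N1 \<Rightarrow> -4 | N2 \<Rightarrow> -5)" for i
      using lowest_window[OF window[OF x] none] by blast
    show "in_window (Lvec lam 1)"
      by (auto simp: in_window_def Lvec_def)
    show "x (-3) = Lvec lam 1 (-3)" "x (-2) = Lvec lam 1 (-2)" "x (-1) = Lvec lam 1 (-1)"
      "x 1 = Lvec lam 1 1" "x 2 = Lvec lam 1 2" "x 3 = Lvec lam 1 3"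
      using x assms le[of N1] le[of N2]
      by (simp_all add: polytope_s2s1s2_def sigma_values[OF window[OF x]]
          Lvec_def l_coord_def a_coef_def a'_coef_def)
  qed
  show "highest_weight_vectors (cartan 2 1) lam (B0 (cartan 2 1) lam) = {Hvec lam 3}"
    "lowest_weight_vectors (cartan 2 1) lam (B0 (cartan 2 1) lam) = {Lvec lam 1}"
    using extremal_vectors_unique[where A = "cartan 2 1" and S = "polytope_s2s1s2 lam",
        OF A stable_polytope_s2s1s2[OF assms] zero window bound H L] by blast+
qed

section \<open>The theorem\<close>

lemma Lvec_eqI:
  assumes "l_coord lam (Suc j) = 0"
  shows "Lvec lam (Suc j) = Lvec lam j"
proof
  show "Lvec lam (Suc j) k = Lvec lam j k" for k
    using assms by (cases "k = int (Suc j)") (auto simp: Lvec_def nat_add_distrib)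
qed

theorem mainTheorem7:
  fixes lam :: "node \<Rightarrow> int"
  defines "A \<equiv> cartan 2 1"
  defines "r \<equiv> real_of_int (lam N1) / real_of_int (- lam N2)"
  defines "HW \<equiv> highest_weight_vectors A lam (B0 A lam)"
  defines "LW \<equiv> lowest_weight_vectors A lam (B0 A lam)"
  assumes "lam N1 > 0" and "lam N2 < 0"
  shows "(r > 2 \<longrightarrow> HW = {Hvec lam 1} \<and> LW = {Lvec lam 3}) \<and>
         (r = 2 \<longrightarrow> HW = {Hvec lam 1} \<and> LW = {Lvec lam 2}) \<and>
         (2 > r \<and> r > 1 \<longrightarrow> HW = {Hvec lam 2} \<and> LW = {Lvec lam 2}) \<and>
         (r = 1 \<longrightarrow> HW = {Hvec lam 2} \<and> LW = {Lvec lam 1}) \<and>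
         (1 > r \<and> r > 0 \<longrightarrow> HW = {Hvec lam 3} \<and> LW = {Lvec lam 1})"
proof -
  have q: "real_of_int (- lam N2) > 0"
    using assms(6) by simp
  then have r_ge: "real_of_int c \<le> r \<longleftrightarrow> c * - lam N2 \<le> lam N1"
    and r_le: "r \<le> real_of_int c \<longleftrightarrow> lam N1 \<le> c * - lam N2" for c
    unfolding r_def pos_le_divide_eq[OF q] pos_divide_le_eq[OF q] of_int_mult[symmetric] of_int_le_iff
    by simp_all
  have ge_2: "HW = {Hvec lam 1} \<and> LW = {Lvec lam 3}" if "r \<ge> 2"
    unfolding HW_def LW_def A_def
    using that extremal_polytope_s2[OF assms(5,6)] r_ge[of 2] by simp
  have mid: "HW = {Hvec lam 2} \<and> LW = {Lvec lam 2}" if "2 > r" "r \<ge> 1"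
    unfolding HW_def LW_def A_def
    using that extremal_polytope_s2s1[OF assms(5,6)] r_ge[of 1] r_le[of 2] by simp
  have le_1: "HW = {Hvec lam 3} \<and> LW = {Lvec lam 1}" if "1 > r"
    unfolding HW_def LW_def A_def
    using that extremal_polytope_s2s1s2[OF assms(5,6)] r_le[of 1] by simp
  \<comment> \<open>On the walls between the chambers the last entry of the lowest weight vector vanishes.\<close>
  have wall_2: "Lvec lam 3 = Lvec lam 2" if "r = 2"
  proof -
    have "lam N1 = - 2 * lam N2"
      using that r_ge[of 2] r_le[of 2] by linarith
    then show ?thesis
      using Lvec_eqI[of lam 2] by (simp add: l_coord_def a_coef_def)
  qed
  have wall_1: "Lvec lam 2 = Lvec lam 1" if "r = 1"
  proof -
    have "lam N1 = - lam N2"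
      using that r_ge[of 1] r_le[of 1] by linarith
    then have "l_coord lam (Suc 1) = 0"
      by (simp add: l_coord_def a'_coef_def)
    then show ?thesis
      using Lvec_eqI[of lam 1] by (simp only: Suc_1)
  qed
  show ?thesis
  proof (intro conjI impI; (elim conjE)?)
    show "HW = {Hvec lam 1}" "LW = {Lvec lam 3}" if "r > 2"
      using that ge_2 by simp_all
    show "HW = {Hvec lam 1}" "LW = {Lvec lam 2}" if "r = 2"
      using that ge_2 wall_2 by simp_all
    show "HW = {Hvec lam 2}" "LW = {Lvec lam 2}" if "2 > r" "r > 1"
      using that mid by simp_all
    show "HW = {Hvec lam 2}" "LW = {Lvec lam 1}" if "r = 1"
      using that mid wall_1 by simp_all
    show "HW = {Hvec lam 3}" "LW = {Lvec lam 1}" if "1 > r" "r > 0"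
      using that le_1 by simp_all
  qed
qed

end
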